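(* Let $r\geq 1$ be an integer and let $\varepsilon\in\{1,2\}$. Then $p_r,\ p_{r+1},\ p_{3r+\varepsilon}$ form a regular sequence in $\mathbb{C}[x,y,z]$ if and only if $r\not\equiv 1\pmod 3$.
   Context: For an integer $m\geq 1$, $p_m=x^m+y^m+z^m\in\mathbb{C}[x,y,z]$ denotes the $m$-th power sum in three variables. *)

theory Defs
  imports
    "HOL-Computational_Algebra.Computational_Algebra"
    "HOL-Number_Theory.Cong"
begin

(* A commutative ring is a module over itself; the span of a set is the ideal it generates. *)
lemma module_times: "module ((*) :: 'a::comm_ring_1 \<Rightarrow> 'a \<Rightarrow> 'a)"
  by (rule module.intro) (simp_all add: algebra_simps)

definition ideal_generated :: "'a::comm_ring_1 set \<Rightarrow> 'a set" where
  "ideal_generated S = module.span (*) S"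

(* f_0, ..., f_{n-1} is regular if multiplication by f_i is injective on R/(f_0, ..., f_{i-1})
   for every i < n, and the quotient R/(f_0, ..., f_{n-1}) is nonzero. Both conditions are
   written for representatives in R; take i fs is f_0, ..., f_{i-1}. *)
definition regular_sequence :: "'a::comm_ring_1 list \<Rightarrow> bool" where
  "regular_sequence fs \<longleftrightarrow>
     (\<forall>i<length fs. \<forall>g. fs ! i * g \<in> ideal_generated (set (take i fs)) \<longrightarrow>
        g \<in> ideal_generated (set (take i fs))) \<and>
     ideal_generated (set fs) \<noteq> UNIV"

(* C[x,y,z] is the iterated polynomial ring C[x][y][z]: the innermost variable is x,
   the outermost one is z. *)
type_synonym poly_xyz = "complex poly poly poly"

definition var_x :: poly_xyz where "var_x = [:[:[:0, 1:]:]:]"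
definition var_y :: poly_xyz where "var_y = [:[:0, 1:]:]"
definition var_z :: poly_xyz where "var_z = [:0, 1:]"

definition power_sum :: "nat \<Rightarrow> poly_xyz" where
  "power_sum m = var_x ^ m + var_y ^ m + var_z ^ m"

lemma eval_power_sum:
  "poly (poly (poly (power_sum m) [:[:c:]:]) [:b:]) a = a ^ m + b ^ m + c ^ m"
  by (simp add: power_sum_def var_x_def var_y_def var_z_def)

end

theory Submission
  imports Defs "HOL-Computational_Algebra.Field_as_Ring"
begin

text \<open>
  If \<open>r mod 3 = 1\<close>, none of the three exponents is divisible by 3, so by Newton's recursion all three
  power sums lie in the ideal \<open>(e\<^sub>1, e\<^sub>2)\<close>, and a regular sequence of length three cannot lie in a
  proper ideal with two generators.

  Otherwise let \<open>(a, b, c)\<close> be a common zero other than the origin. The first two equations give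
  \<open>(a\<^sup>r, b\<^sup>r, c\<^sup>r) = l (b - c, c - a, a - b)\<close>, whence \<open>p (3 r + \<epsilon>)\<close> is \<open>l\<^sup>3\<close> times the Vandermonde
  product times \<open>e\<^sub>\<epsilon>\<close>. Estimates of the moduli show that the vanishing of one of \<open>e\<^sub>1, e\<^sub>2\<close> forces that
  of the other; then \<open>a\<^sup>3 = b\<^sup>3 = c\<^sup>3\<close>, which needs \<open>r mod 3 = 1\<close>. Since the only common zero is the
  origin, a power of \<open>z\<close> lies in the ideal of the three power sums; as \<open>z\<close> is a nonzerodivisor modulo
  the first two, so is the third one.
\<close>

section \<open>Common zeros\<close>

text \<open>The parallelogram law for \<open>b\<close> and \<open>c\<close>, since
  \<open>b + c = - a\<close>. In this form the right side is the same affine function of the squared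
  modulus for each of the three numbers.\<close>

lemma parallelogram_zero_sum:
  fixes a b c :: complex
  assumes "a + b + c = 0"
  shows "(cmod (b - c))\<^sup>2 = 2 * ((cmod a)\<^sup>2 + (cmod b)\<^sup>2 + (cmod c)\<^sup>2) - 3 * (cmod a)\<^sup>2"
proof -
  have a: "a = - (b + c)" using assms by (metis add.assoc eq_neg_iff_add_eq_0)
  show ?thesis unfolding a by (simp only: norm_minus_cancel) (simp add: cmod_power2, simp add: power2_eq_square algebra_simps)
qed

text \<open>Under the bilinear dot product, (1, 1, 1) and (a, b, c) annihilate the vector of
  \<open>r\<close>-th powers, which is thus a multiple of their cross product. If two of the numbers
  agreed, the equations would make all three agree, and then 3 c^r = 0.\<close>

lemma power_sums_proportional:
  fixes a b c :: complex
  assumes p1: "a ^ r + b ^ r + c ^ r = 0" and p2: "a ^ (r + 1) + b ^ (r + 1) + c ^ (r + 1) = 0"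
    and r: "r \<ge> 1" and nz: "c \<noteq> 0"
  obtains l where "l \<noteq> 0" "a ^ r = l * (b - c)" "b ^ r = l * (c - a)" "c ^ r = l * (a - b)"
    "a \<noteq> 0" "b \<noteq> 0" "a \<noteq> b" "b \<noteq> c" "c \<noteq> a"
proof -
  have q: "a * a ^ r + b * b ^ r + c * c ^ r = 0" using p2 by simp
  define A where "A = a ^ r"
  define B where "B = b ^ r"
  define C where "C = c ^ r"
  have p: "A + B + C = 0" "a * A + b * B + c * C = 0" using p1 q by (simp_all add: A_def B_def C_def)
  have C0: "C \<noteq> 0" using nz by (simp add: C_def)
  have ab: "a \<noteq> b"
  proof
    assume e: "a = b"
    hence "A = B" by (simp add: A_def B_def)
    hence C: "C = - 2 * A" using p by (simp add: eq_neg_iff_add_eq_0 add.commute)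
    have "2 * A * (a - c) = a * A + b * B + c * C"
      unfolding C e \<open>A = B\<close> by (simp add: algebra_simps)
    hence "2 * A * (a - c) = 0" using p(2) by simp
    hence "a = c" using C0 C by auto
    hence "A = C" by (simp add: A_def C_def)
    thus False using C C0 by (simp add: eq_neg_iff_add_eq_0)
  qed
  have bc: "b \<noteq> c"
  proof
    assume e: "b = c"
    hence "B = C" by (simp add: B_def C_def)
    hence A: "A = - 2 * C" using p by (simp add: eq_neg_iff_add_eq_0 add.assoc)
    have "2 * C * (c - a) = a * A + b * B + c * C"
      unfolding A e \<open>B = C\<close> by (simp add: algebra_simps)
    hence "2 * C * (c - a) = 0" using p(2) by simp
    hence "c = a" using C0 by auto
    hence "A = C" by (simp add: A_def C_def)
    thus False using A C0 by (simp add: eq_neg_iff_add_eq_0)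
  qed
  have ca: "c \<noteq> a"
  proof
    assume e: "c = a"
    hence "A = C" by (simp add: A_def C_def)
    hence B: "B = - 2 * C" using p by (simp add: eq_neg_iff_add_eq_0 algebra_simps)
    have "2 * C * (c - b) = a * A + b * B + c * C"
      unfolding B e \<open>A = C\<close> by (simp add: algebra_simps)
    hence "2 * C * (c - b) = 0" using p(2) by simp
    thus False using C0 bc by auto
  qed
  define l where "l = C / (a - b)"
  have C: "C = l * (a - b)" using ab by (simp add: l_def)
  have l0: "l \<noteq> 0" using C0 C by auto
  have B': "B = - A - C" using p(1) by (simp add: algebra_simps eq_neg_iff_add_eq_0)
  have "(A - l * (b - c)) * (a - b) = A * (a - b) - C * (b - c)" by (simp add: C algebra_simps)
  also have "\<dots> = a * A + b * B + c * C" by (simp add: B' algebra_simps)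
  finally have "(A - l * (b - c)) * (a - b) = 0" using p(2) by simp
  hence A: "A = l * (b - c)" using ab by simp
  have B: "B = l * (c - a)" by (simp add: B' A C algebra_simps)
  show ?thesis
  proof (rule that[OF l0])
    show "a ^ r = l * (b - c)" "b ^ r = l * (c - a)" "c ^ r = l * (a - b)" using A B C by (simp_all add: A_def B_def C_def)
    show "a \<noteq> 0" using A l0 bc r by (auto simp: A_def zero_power)
    show "b \<noteq> 0" using B l0 ca r by (auto simp: B_def zero_power)
  qed fact+
qed

text \<open>The three numbers are roots of T^3 = abc, so their cubes agree and their
  \<open>n\<close>-th powers sum to 3 c^n whenever 3 divides \<open>n\<close>. Hence 3 divides
  neither \<open>r\<close> nor \<open>r + 1\<close>.\<close>

lemma e1_e2_zero_imp:
  fixes a b c :: complex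
  assumes e1: "a + b + c = 0" and e2: "a * b + b * c + c * a = 0"
    and p1: "a ^ r + b ^ r + c ^ r = 0" and p2: "a ^ (r + 1) + b ^ (r + 1) + c ^ (r + 1) = 0"
    and nz: "c \<noteq> 0"
  shows "r mod 3 = 1"
proof -
  have cub: "a ^ 3 = c ^ 3" "b ^ 3 = c ^ 3"
  proof -
    have "a ^ 3 - c ^ 3 = (a - c) * ((a + c) * (a + b + c) - (a * b + b * c + c * a))"
      "b ^ 3 - c ^ 3 = (b - c) * ((b + c) * (a + b + c) - (a * b + b * c + c * a))"
      by (simp_all add: algebra_simps power3_eq_cube)
    thus "a ^ 3 = c ^ 3" "b ^ 3 = c ^ 3" by (simp_all add: e1 e2)
  qed
  have key: "a ^ n + b ^ n + c ^ n \<noteq> 0" if "3 dvd n" for n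
  proof -
    from that obtain k where n: "n = 3 * k" by blast
    have "a ^ n + b ^ n + c ^ n = 3 * c ^ n" by (simp add: n power_mult cub)
    thus ?thesis using nz by simp
  qed
  have "\<not> 3 dvd r" "\<not> 3 dvd (r + 1)" using key p1 p2 by blast+
  thus ?thesis by presburger
qed

text \<open>In a triangle with centroid 0 the side opposite to a vertex gets shorter as the modulus of that
  vertex grows, whereas \<open>a ^ r = l (b - c)\<close> makes it longer. So the triangle is equilateral.\<close>

lemma e1_zero_imp_e2_zero:
  fixes a b c :: complex
  assumes e1: "a + b + c = 0" and r: "r \<ge> 1"
    and p1: "a ^ r + b ^ r + c ^ r = 0" and p2: "a ^ (r + 1) + b ^ (r + 1) + c ^ (r + 1) = 0"
    and nz: "c \<noteq> 0"
  shows "a * b + b * c + c * a = 0"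
proof -
  from power_sums_proportional[OF p1 p2 r nz] obtain l where l: "l \<noteq> 0"
    "a ^ r = l * (b - c)" "b ^ r = l * (c - a)" "c ^ r = l * (a - b)" "a \<noteq> 0" "b \<noteq> 0" .
  define S where "S = (cmod a)\<^sup>2 + (cmod b)\<^sup>2 + (cmod c)\<^sup>2"
  define L where "L = (cmod l)\<^sup>2"
  have L: "L > 0" using l by (simp add: L_def)
  have A: "((cmod a)\<^sup>2) ^ r = L * (2 * S - 3 * (cmod a)\<^sup>2)"
    using arg_cong[OF l(2), of "\<lambda>x. (cmod x)\<^sup>2"] parallelogram_zero_sum[OF e1]
    by (simp add: norm_mult norm_power power_mult_distrib L_def S_def flip: power_mult) (simp add: mult.commute)
  have e1': "b + c + a = 0" "c + a + b = 0" using e1 by (simp_all add: algebra_simps)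
  have B: "((cmod b)\<^sup>2) ^ r = L * (2 * S - 3 * (cmod b)\<^sup>2)"
    using arg_cong[OF l(3), of "\<lambda>x. (cmod x)\<^sup>2"] parallelogram_zero_sum[OF e1'(1)]
    by (simp add: norm_mult norm_power power_mult_distrib L_def S_def add_ac flip: power_mult) (simp add: mult.commute)
  have C: "((cmod c)\<^sup>2) ^ r = L * (2 * S - 3 * (cmod c)\<^sup>2)"
    using arg_cong[OF l(4), of "\<lambda>x. (cmod x)\<^sup>2"] parallelogram_zero_sum[OF e1'(2)]
    by (simp add: norm_mult norm_power power_mult_distrib L_def S_def add_ac flip: power_mult) (simp add: mult.commute)
  \<comment> \<open>The left side grows with \<open>x\<close> and the right side falls, so there is
    at most one nonnegative solution; use in both directions gives equal moduli.\<close>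
  have le: "x \<ge> y" if "x ^ r = L * (2 * S - 3 * x)" "y ^ r = L * (2 * S - 3 * y)" "x \<ge> 0" for x y :: real
  proof (rule ccontr)
    assume "\<not> x \<ge> y"
    hence "x ^ r < y ^ r" "L * (2 * S - 3 * y) < L * (2 * S - 3 * x)"
      using L r that(3) by (auto intro!: power_strict_mono mult_strict_left_mono)
    with that show False by linarith
  qed
  have "(cmod a)\<^sup>2 = (cmod c)\<^sup>2" "(cmod b)\<^sup>2 = (cmod c)\<^sup>2"
    using le[OF A C] le[OF C A] le[OF B C] le[OF C B] by simp_all
  hence m: "a * cnj a = c * cnj c" "b * cnj b = c * cnj c"
    by (simp_all flip: complex_norm_square)
  \<comment> \<open>For equal moduli the conjugates are proportional to the reciprocals, so
    conjugating \<open>e1\<close> says that the reciprocals sum to 0.\<close>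
  have "cnj a + cnj b + cnj c = 0" using arg_cong[OF e1, of cnj] by simp
  hence "0 = a * b * c * (cnj a + cnj b + cnj c)" by simp
  also have "\<dots> = b * c * (a * cnj a) + c * a * (b * cnj b) + a * b * (c * cnj c)"
    by (simp add: algebra_simps)
  also have "\<dots> = (c * cnj c) * (a * b + b * c + c * a)"
    unfolding m by (simp add: algebra_simps)
  finally have "(c * cnj c) * (a * b + b * c + c * a) = 0" by simp
  thus ?thesis using nz by simp
qed

section \<open>Modulus estimates when the second elementary symmetric function vanishes\<close>

text \<open>By the mean value theorem, three points of the graph on one line would give the
  derivative the value \<open>P\<close> at two different points, but it is strictly increasing on
  the positive axis.\<close>

lemma convex_power_affine:
  fixes x y z P Q :: real
  assumes "0 < x" "x < y" "y < z" "n \<ge> 2"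
    and "x ^ n = P * x + Q" "y ^ n = P * y + Q" "z ^ n = P * z + Q"
  shows False
proof -
  have mvt: "\<exists>t. u < t \<and> t < v \<and> P = real n * t ^ (n - 1)"
    if "u < v" "u ^ n = P * u + Q" "v ^ n = P * v + Q" for u v
  proof -
    have "\<exists>t. u < t \<and> t < v \<and> v ^ n - u ^ n = (v - u) * (real n * t ^ (n - 1))"
      using that(1) by (intro MVT2) (auto intro!: derivative_eq_intros)
    then obtain t where t: "u < t" "t < v" "v ^ n - u ^ n = (v - u) * (real n * t ^ (n - 1))" by blast
    have "(v - u) * P = v ^ n - u ^ n" using that by (simp add: algebra_simps)
    hence "(v - u) * P = (v - u) * (real n * t ^ (n - 1))" using t(3) by (simp only:)
    thus ?thesis using t that(1) by auto
  qed
  obtain s where s: "x < s" "s < y" "P = real n * s ^ (n - 1)" using mvt assms by blast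
  obtain t where t: "y < t" "t < z" "P = real n * t ^ (n - 1)" using mvt assms by blast
  have "s ^ (n - 1) < t ^ (n - 1)" using s t assms by (intro power_strict_mono) auto
  thus False using s t assms by simp
qed

text \<open>This is |sin (n t)| \<le> n |sin t|, proved with the addition formula.\<close>

lemma Im_power_le:
  assumes "cmod a = 1"
  shows "\<bar>Im (a ^ n)\<bar> \<le> real n * \<bar>Im a\<bar>"
proof (induction n)
  case (Suc n)
  have 1: "cmod (a ^ n) = 1" using assms by (simp add: norm_power)
  have "\<bar>Im (a ^ Suc n)\<bar> = \<bar>Re a * Im (a ^ n) + Im a * Re (a ^ n)\<bar>" by simp
  also have "\<dots> \<le> \<bar>Re a\<bar> * \<bar>Im (a ^ n)\<bar> + \<bar>Im a\<bar> * \<bar>Re (a ^ n)\<bar>"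
    by (metis abs_mult abs_triangle_ineq)
  also have "\<dots> \<le> 1 * \<bar>Im (a ^ n)\<bar> + \<bar>Im a\<bar> * 1"
    using abs_Re_le_cmod[of a] abs_Re_le_cmod[of "a ^ n"] assms 1
    by (intro add_mono mult_mono) auto
  finally show ?case using Suc by (simp add: algebra_simps)
qed auto

lemma square_less_power3: "3 * r\<^sup>2 + 1 < 4 * 3 ^ r" if "r \<ge> 2" for r :: nat
  using that
proof (induction r rule: dec_induct)
  case (step n)
  have "3 * (Suc n)\<^sup>2 + 1 \<le> 3 * (3 * n\<^sup>2 + 1)"
  proof -
    have "2 * n \<le> n * n" using step(1) by (rule mult_le_mono1)
    with step(1) show ?thesis unfolding power2_eq_square mult_Suc mult_Suc_right by presburger
  qed
  thus ?case using step by simp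
qed auto

text \<open>Besides 1, the equation \<open>eq\<close> has a spurious root between 1/4 and 1/3. The
  inequality \<open>le\<close> excludes it, its right side being less than 4 for q \<le>
  1/3.\<close>

lemma normalised_root_eq_1:
  fixes q :: real
  assumes r: "r \<ge> 2" and q: "q > 0" and eq: "4 * q - 1 = q ^ (r + 1) * (q + 2)"
    and le: "4 \<le> q ^ r * (1 + (real r)\<^sup>2 * (q + 2))"
  shows "q = 1"
proof (rule ccontr)
  assume "q \<noteq> 1"
  show False
  proof (cases "q > 1")
    case True
    \<comment> \<open>As \<open>r \<ge> 2\<close>, the exponent can be replaced by 2 here and by 3
      in the other case; the resulting cubic and quartic have the root 1, which splits off.\<close>
    have "q ^ 2 * (q + 2) \<le> q ^ (r + 1) * (q + 2)"
      using True r by (intro mult_right_mono power_increasing) auto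
    hence "q ^ 3 + 2 * q ^ 2 - 4 * q + 1 \<le> 0" using eq by (simp add: algebra_simps power3_eq_cube power2_eq_square)
    hence "(q - 1) * (q ^ 2 + 3 * q - 1) \<le> 0" by (simp add: algebra_simps power3_eq_cube power2_eq_square)
    moreover have "(q - 1) * (q ^ 2 + 3 * q - 1) > 0" using True
      by (intro mult_pos_pos) (auto intro: add_pos_pos simp: add_strict_increasing2)
    ultimately show False by linarith
  next
    case False
    hence q1: "q < 1" using \<open>q \<noteq> 1\<close> by simp
    have "q ^ (r + 1) * (q + 2) \<le> q ^ 3 * (q + 2)"
      using q1 r q by (intro mult_right_mono power_decreasing) auto
    hence "(1 - q) * (1 - (q ^ 3 + 3 * q\<^sup>2 + 3 * q)) \<ge> 0" using eq by (simp add: algebra_simps power3_eq_cube power2_eq_square)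
    hence "q ^ 3 + 3 * q\<^sup>2 + 3 * q \<le> 1" using q1 by (simp add: zero_le_mult_iff)
    moreover have "q ^ 3 > 0" "q\<^sup>2 > 0" using q by simp_all
    ultimately have q3: "q \<le> 1 / 3" by linarith
    have "q ^ r * (1 + (real r)\<^sup>2 * (q + 2)) \<le> (1 / 3) ^ r * (1 + (real r)\<^sup>2 * 3)"
      using q3 q by (intro mult_mono power_mono add_mono) auto
    with le have "4 \<le> (1 / 3) ^ r * (1 + (real r)\<^sup>2 * 3)" by linarith
    hence "4 * 3 ^ r \<le> 1 + 3 * (real r)\<^sup>2" by (simp add: field_simps)
    hence "real (4 * 3 ^ r) \<le> real (3 * r\<^sup>2 + 1)" by simp
    hence "4 * 3 ^ r \<le> 3 * r\<^sup>2 + 1" by (simp only: of_nat_le_iff)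
    thus False using square_less_power3[OF r] by simp
  qed
qed

text \<open>Here \<open>a\<close>, its conjugate and \<open>d\<close> are the three numbers; the first assumption on \<open>d\<close> says that
  their second elementary symmetric function vanishes.\<close>

lemma conj_pair_e1_zero:
  fixes a :: complex and d :: real
  assumes a: "cmod a = 1" and d: "d * (2 * Re a) = -1" and r: "r \<ge> 2"
    and p1: "2 * Re (a ^ r) = - (d ^ r)" and p2: "2 * Re (a ^ (r + 1)) = - (d ^ (r + 1))"
  shows "d + 2 * Re a = 0"
proof -
  define q where "q = d\<^sup>2"
  define X Y U V where "X = Re a" and "Y = Im a" and "U = Re (a ^ r)" and "V = Im (a ^ r)"
  have d0: "d \<noteq> 0" using d by auto
  have q0: "q > 0" using d0 by (simp add: q_def)
  have XY: "X\<^sup>2 + Y\<^sup>2 = 1" using a cmod_power2[of a] by (simp add: X_def Y_def)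
  have UV: "U\<^sup>2 + V\<^sup>2 = 1" using a cmod_power2[of "a ^ r"] by (simp add: U_def V_def norm_power)
  have VY: "V\<^sup>2 \<le> (real r)\<^sup>2 * Y\<^sup>2"
    using power_mono[OF Im_power_le[OF a, of r], of 2] by (simp add: V_def Y_def power_mult_distrib)
  have X: "X = - 1 / (2 * d)" using d d0 by (simp add: X_def field_simps)
  have U: "U = - (d ^ r) / 2" using p1 by (simp add: U_def)
  have "2 * (X * U - Y * V) = - (d ^ (r + 1))" using p2 by (simp add: X_def Y_def U_def V_def)
  hence YV: "4 * d * (Y * V) = d ^ r * (1 + 2 * q)"
    using d0 unfolding X U q_def by (simp add: field_simps power2_eq_square)
  have Y2: "4 * q * Y\<^sup>2 = 4 * q - 1" using XY d0 unfolding X q_def by (simp add: field_simps power2_eq_square)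
  have V2: "4 * V\<^sup>2 = 4 - q ^ r" using UV unfolding U q_def by (simp add: power_divide flip: power_mult) (simp add: mult.commute)
  \<comment> \<open>Squaring \<open>YV\<close> allows both imaginary parts to be eliminated through
    \<open>Y2\<close> and \<open>V2\<close>, which leaves an equation in \<open>q\<close>
    alone.\<close>
  have "16 * q * (Y\<^sup>2 * V\<^sup>2) = q ^ r * (1 + 2 * q)\<^sup>2"
    using arg_cong[OF YV, of "\<lambda>x. x\<^sup>2"] unfolding q_def power_mult_distrib
    by (simp flip: power_mult) (simp add: mult.commute)
  moreover have "16 * q * (Y\<^sup>2 * V\<^sup>2) = (4 * q * Y\<^sup>2) * (4 * V\<^sup>2)" by simp
  ultimately have "(4 * q - 1) * (4 - q ^ r) = q ^ r * (1 + 2 * q)\<^sup>2" unfolding Y2 V2 by simp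
  hence eq: "4 * q - 1 = q ^ (r + 1) * (q + 2)" by (simp add: power2_eq_square algebra_simps)
  \<comment> \<open>A second constraint on \<open>q\<close>, from the bound of \<open>V\<close> by
    \<open>r\<close> times \<open>Y\<close>.\<close>
  have "q * (4 - q ^ r) = q * (4 * V\<^sup>2)" by (simp add: V2)
  also have "\<dots> \<le> q * (4 * ((real r)\<^sup>2 * Y\<^sup>2))" using VY q0 by (intro mult_left_mono) auto
  also have "\<dots> = (real r)\<^sup>2 * (4 * q * Y\<^sup>2)" by simp
  also have "\<dots> = q * ((real r)\<^sup>2 * (q ^ r * (q + 2)))" unfolding Y2 eq by simp
  finally have "4 - q ^ r \<le> (real r)\<^sup>2 * (q ^ r * (q + 2))" using q0 by simp
  hence "4 \<le> q ^ r * (1 + (real r)\<^sup>2 * (q + 2))" by (simp add: algebra_simps)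
  hence "q = 1" by (rule normalised_root_eq_1[OF r q0 eq])
  hence "d * (d + 2 * Re a) = 0" using d unfolding q_def by (simp add: distrib_left power2_eq_square)
  thus ?thesis using d0 by simp
qed

text \<open>Division by a square root of \<open>a * b\<close> turns \<open>a\<close> and
  \<open>b\<close> into numbers of equal modulus with product 1, that is, conjugates on the unit
  circle. Then \<open>e2\<close> forces the third number to be real.\<close>

lemma equal_modulus_e1_zero:
  fixes a b c :: complex
  assumes m: "cmod a = cmod b" and a: "a \<noteq> 0" and e2: "a * b + b * c + c * a = 0" and r: "r \<ge> 2"
    and p1: "a ^ r + b ^ r + c ^ r = 0" and p2: "a ^ (r + 1) + b ^ (r + 1) + c ^ (r + 1) = 0"
  shows "a + b + c = 0"
proof -
  define s where "s = csqrt (a * b)"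
  have s2: "s\<^sup>2 = a * b" by (simp add: s_def)
  have b: "b \<noteq> 0" using m a by auto
  have s0: "s \<noteq> 0" using a b by (simp add: s_def)
  define u v w where "u = a / s" and "v = b / s" and "w = c / s"
  have abc: "a = u * s" "b = v * s" "c = w * s" using s0 by (simp_all add: u_def v_def w_def)
  have uv: "u * v = 1" using s2 s0 unfolding abc by (simp add: power2_eq_square)
  have "cmod u = cmod v" using m s0 unfolding abc by (simp add: norm_mult)
  moreover have "cmod u * cmod v = 1" using uv by (metis norm_mult norm_one)
  ultimately have "(cmod u)\<^sup>2 = 1" by (simp add: power2_eq_square)
  hence cu: "cmod u = 1" by (simp add: power2_eq_1_iff) (smt (verit) norm_ge_zero)
  have "u * cnj u = 1" using cu by (simp flip: complex_norm_square)
  hence v: "v = cnj u" using uv by (metis mult.assoc mult.commute mult.right_neutral)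
  have "(u * v + w * (u + v)) * s\<^sup>2 = 0" using e2 unfolding abc by (simp add: power2_eq_square algebra_simps)
  hence "1 + w * (u + v) = 0" using s0 uv by simp
  hence w1: "w * complex_of_real (2 * Re u) = - 1" unfolding v by (simp add: complex_add_cnj eq_neg_iff_add_eq_0 add.commute)
  define d where "d = Re w"
  have "w = - 1 / complex_of_real (2 * Re u)" using w1 by (metis div_by_0 mult_zero_right nonzero_mult_div_cancel_right zero_neq_neg_one)
  hence "w = complex_of_real (- 1 / (2 * Re u))" by simp
  hence w: "w = complex_of_real d" unfolding d_def by (metis Re_complex_of_real)
  have d1: "d * (2 * Re u) = - 1"
    using arg_cong[OF w1, of Re] unfolding w by simp
  have p: "2 * Re (u ^ n) = - (d ^ n)" if "a ^ n + b ^ n + c ^ n = 0" for n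
  proof -
    have "(u ^ n + v ^ n + w ^ n) * s ^ n = 0" using that unfolding abc by (simp add: power_mult_distrib algebra_simps)
    hence "u ^ n + cnj (u ^ n) + complex_of_real (d ^ n) = 0" using s0 by (simp add: v w)
    from arg_cong[OF this, of Re] show ?thesis by (simp del: complex_cnj_power)
  qed
  have "d + 2 * Re u = 0" by (rule conj_pair_e1_zero[OF cu d1 r p[OF p1] p[OF p2]])
  hence "complex_of_real (d + 2 * Re u) = 0" by simp
  hence "u + v + w = 0" unfolding v w complex_add_cnj by (simp add: add.commute)
  moreover have "a + b + c = (u + v + w) * s" unfolding abc by (simp add: algebra_simps)
  ultimately show ?thesis by simp
qed

text \<open>The reciprocals sum to 0, so the parallelogram law makes the three squared moduli solutions of
  \<open>x ^ (r + 2) = P x + Q\<close>, which by convexity has at most two positive solutions: two of the numbers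
  have equal modulus, and after scaling they are complex conjugates.\<close>

lemma e2_zero_imp_e1_zero:
  fixes a b c :: complex
  assumes e2: "a * b + b * c + c * a = 0" and r: "r \<ge> 2"
    and p1: "a ^ r + b ^ r + c ^ r = 0" and p2: "a ^ (r + 1) + b ^ (r + 1) + c ^ (r + 1) = 0"
    and nz: "c \<noteq> 0"
  shows "a + b + c = 0"
proof -
  have r1: "r \<ge> 1" using r by simp
  from power_sums_proportional[OF p1 p2 r1 nz] obtain l where l: "l \<noteq> 0"
    "a ^ r = l * (b - c)" "b ^ r = l * (c - a)" "c ^ r = l * (a - b)" and a: "a \<noteq> 0" and b: "b \<noteq> 0" .
  define S where "S = (cmod (1/a))\<^sup>2 + (cmod (1/b))\<^sup>2 + (cmod (1/c))\<^sup>2"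
  define K where "K = (cmod l * cmod a * cmod b * cmod c)\<^sup>2"
  have K: "K > 0" using l a b nz by (simp add: K_def)
  have key: "((cmod x)\<^sup>2) ^ (r + 2) = 2 * K * S * (cmod x)\<^sup>2 + (- 3 * K)"
    if x: "x ^ r = l * (y - z)" and nz: "x \<noteq> 0" "y \<noteq> 0" "z \<noteq> 0" and e: "x * y + y * z + z * x = 0"
      and S: "S = (cmod (1/x))\<^sup>2 + (cmod (1/y))\<^sup>2 + (cmod (1/z))\<^sup>2"
      and K: "K = (cmod l * cmod x * cmod y * cmod z)\<^sup>2" for x y z
  proof -
    have "x * y * z * (1 / x + 1 / y + 1 / z) = x * y + y * z + z * x"
      using nz by (simp add: distrib_left)
    hence 0: "1 / x + 1 / y + 1 / z = 0" using e nz by simp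
    \<comment> \<open>With the difference expressed by reciprocals, \<open>x ^ r\<close> is
      multiplied by x^2: one factor completes the symmetric constant \<open>K\<close>, the other
      cancels the |1/x|^2 of the parallelogram law.\<close>
    have "y * z * (1 / y - 1 / z) = z - y" using nz by (simp add: right_diff_distrib)
    hence "- (l * x * y * z * (1 / y - 1 / z)) * x = - (l * x * (z - y)) * x" by (simp only: mult.assoc)
    also have "\<dots> = x ^ (r + 2)"
      by (simp add: x power_add power2_eq_square right_diff_distrib left_diff_distrib mult_ac)
    finally have "x ^ (r + 2) = - (l * x * y * z * (1 / y - 1 / z)) * x" ..
    hence "(cmod x) ^ (r + 2) = (cmod l * cmod x * cmod y * cmod z) * cmod (1 / y - 1 / z) * cmod x"
      by (metis (no_types) norm_minus_cancel norm_mult norm_power)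
    hence "((cmod x) ^ (r + 2))\<^sup>2 = K * (cmod (1 / y - 1 / z))\<^sup>2 * (cmod x)\<^sup>2"
      by (simp only: K power_mult_distrib)
    also have "\<dots> = K * (2 * S - 3 * (cmod (1 / x))\<^sup>2) * (cmod x)\<^sup>2"
      by (simp only: parallelogram_zero_sum[OF 0] S)
    also have "\<dots> = 2 * K * S * (cmod x)\<^sup>2 + (- 3 * K)"
      using nz by (simp add: norm_divide field_simps)
    finally show ?thesis by (simp only: mult.commute flip: power_mult)
  qed
  have A: "((cmod a)\<^sup>2) ^ (r + 2) = 2 * K * S * (cmod a)\<^sup>2 + (- 3 * K)"
    by (rule key[OF l(2) a b nz e2]) (simp_all add: S_def K_def)
  have B: "((cmod b)\<^sup>2) ^ (r + 2) = 2 * K * S * (cmod b)\<^sup>2 + (- 3 * K)"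
    by (rule key[OF l(3) b nz a]) (use e2 in \<open>simp_all add: S_def K_def ac_simps\<close>)
  have C: "((cmod c)\<^sup>2) ^ (r + 2) = 2 * K * S * (cmod c)\<^sup>2 + (- 3 * K)"
    by (rule key[OF l(4) nz a b]) (use e2 in \<open>simp_all add: S_def K_def ac_simps\<close>)
  define P where "P = (\<lambda>x::real. x > 0 \<and> x ^ (r + 2) = 2 * K * S * x + (- 3 * K))"
  have distinct: False if "x < y" "y < z" "P x" "P y" "P z" for x y z
  proof (rule convex_power_affine)
    show "0 < x" "x ^ (r + 2) = 2 * K * S * x + (- 3 * K)" using that(3) unfolding P_def by blast+
    show "y ^ (r + 2) = 2 * K * S * y + (- 3 * K)" using that(4) unfolding P_def by blast
    show "z ^ (r + 2) = 2 * K * S * z + (- 3 * K)" using that(5) unfolding P_def by blast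
    show "2 \<le> r + 2" by simp
  qed fact+
  have eq: "x = y \<or> y = z \<or> z = x" if P: "P x" "P y" "P z" for x y z
  proof (rule ccontr)
    assume "\<not> (x = y \<or> y = z \<or> z = x)"
    hence "(x < y \<and> y < z) \<or> (x < z \<and> z < y) \<or> (y < x \<and> x < z) \<or> (y < z \<and> z < x) \<or> (z < x \<and> x < y) \<or> (z < y \<and> y < x)"
      by linarith
    thus False using P distinct by blast
  qed
  have "0 < (cmod a)\<^sup>2" "0 < (cmod b)\<^sup>2" "0 < (cmod c)\<^sup>2" using a b nz by simp_all
  hence "P ((cmod a)\<^sup>2)" "P ((cmod b)\<^sup>2)" "P ((cmod c)\<^sup>2)"
    unfolding P_def using A B C by blast+
  from eq[OF this] have "(cmod a)\<^sup>2 = (cmod b)\<^sup>2 \<or> (cmod b)\<^sup>2 = (cmod c)\<^sup>2 \<or> (cmod c)\<^sup>2 = (cmod a)\<^sup>2" .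
  hence "cmod a = cmod b \<or> cmod b = cmod c \<or> cmod c = cmod a" by (simp add: power2_eq_iff_nonneg)
  thus ?thesis
  proof (elim disjE)
    assume m: "cmod a = cmod b"
    show ?thesis by (rule equal_modulus_e1_zero[OF m a e2 r p1 p2])
  next
    assume m: "cmod b = cmod c"
    have "b + c + a = 0"
      by (rule equal_modulus_e1_zero[OF m b _ r]) (use e2 p1 p2 in \<open>simp_all add: add_ac\<close>)
    thus ?thesis by (simp add: add_ac)
  next
    assume m: "cmod c = cmod a"
    have "c + a + b = 0"
      by (rule equal_modulus_e1_zero[OF m nz _ r]) (use e2 p1 p2 in \<open>simp_all add: add_ac\<close>)
    thus ?thesis by (simp add: add_ac)
  qed
qed

lemma power_sums_no_common_zero:
  fixes a b c :: complex
  assumes r: "r \<ge> 1" "r mod 3 \<noteq> 1" and \<epsilon>: "\<epsilon> \<in> {1, 2}" and nz: "c \<noteq> 0"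
    and p1: "a ^ r + b ^ r + c ^ r = 0" and p2: "a ^ (r + 1) + b ^ (r + 1) + c ^ (r + 1) = 0"
  shows "a ^ (3 * r + \<epsilon>) + b ^ (3 * r + \<epsilon>) + c ^ (3 * r + \<epsilon>) \<noteq> 0"
proof
  assume p3: "a ^ (3 * r + \<epsilon>) + b ^ (3 * r + \<epsilon>) + c ^ (3 * r + \<epsilon>) = 0"
  from power_sums_proportional[OF p1 p2 r(1) nz] obtain l where l: "l \<noteq> 0"
    "a ^ r = l * (b - c)" "b ^ r = l * (c - a)" "c ^ r = l * (a - b)"
    and d: "a \<noteq> b" "b \<noteq> c" "c \<noteq> a" .
  have "x ^ (3 * r + \<epsilon>) = (x ^ r) ^ 3 * x ^ \<epsilon>" for x :: complex
    by (simp add: power_add mult.commute flip: power_mult)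
  hence "0 = l ^ 3 * ((b - c) ^ 3 * a ^ \<epsilon> + (c - a) ^ 3 * b ^ \<epsilon> + (a - b) ^ 3 * c ^ \<epsilon>)"
    using p3 by (simp only: l power_mult_distrib) (simp add: distrib_left mult.assoc)
  hence 0: "(b - c) ^ 3 * a ^ \<epsilon> + (c - a) ^ 3 * b ^ \<epsilon> + (a - b) ^ 3 * c ^ \<epsilon> = 0" using l(1) by simp
  have "a + b + c = 0 \<and> a * b + b * c + c * a = 0"
  proof (cases "\<epsilon> = 1")
    case True
    have "(b - c) ^ 3 * a + (c - a) ^ 3 * b + (a - b) ^ 3 * c = (a - b) * (b - c) * (c - a) * (a + b + c)"
      by (simp add: power3_eq_cube algebra_simps)
    hence "a + b + c = 0" using 0 d True by simp
    thus ?thesis using e1_zero_imp_e2_zero[OF _ r(1) p1 p2 nz] by blast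
  next
    case False
    hence "\<epsilon> = 2" using \<epsilon> by simp
    have "(b - c) ^ 3 * a ^ 2 + (c - a) ^ 3 * b ^ 2 + (a - b) ^ 3 * c ^ 2
          = (a - b) * (b - c) * (c - a) * (a * b + b * c + c * a)"
      by (simp add: power3_eq_cube power2_eq_square algebra_simps)
    hence "a * b + b * c + c * a = 0" using 0 d \<open>\<epsilon> = 2\<close> by simp
    \<comment> \<open>The congruence condition excludes \<open>r = 1\<close>.\<close>
    moreover have "r \<ge> 2" using r by (cases "r = 1") auto
    ultimately show ?thesis using e2_zero_imp_e1_zero[OF _ _ p1 p2 nz] by blast
  qed
  thus False using e1_e2_zero_imp[OF _ _ p1 p2 nz] r(2) by blast
qed

section \<open>Regular sequences in two-generated ideals\<close>

lemma ideal_generated_empty: "ideal_generated {} = {0::'a::comm_ring_1}"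
  unfolding ideal_generated_def by (rule module.span_empty[OF module_times])

lemma ideal_generated_insert:
  "ideal_generated (insert a S) = {x::'a::comm_ring_1. \<exists>k. x - k * a \<in> ideal_generated S}"
  unfolding ideal_generated_def by (rule module.span_insert[OF module_times])

lemma in_ideal_generated_1: "x \<in> ideal_generated {a} \<longleftrightarrow> (a::'a::comm_ring_1) dvd x"
  by (auto simp: ideal_generated_insert ideal_generated_empty dvd_def mult.commute)

lemma in_ideal_generated_2: "x \<in> ideal_generated {a, b} \<longleftrightarrow> (\<exists>u v. x = u * a + v * (b::'a::comm_ring_1))"
  by (auto simp: ideal_generated_insert ideal_generated_empty algebra_simps)

lemma in_ideal_generated_3:
  "x \<in> ideal_generated {a, b, c} \<longleftrightarrow> (\<exists>u v w. x = u * a + v * b + w * (c::'a::comm_ring_1))"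
proof -
  have "x \<in> ideal_generated {a, b, c} \<longleftrightarrow> (\<exists>u v w. x - u * a = v * b + w * c)"
    by (simp add: ideal_generated_insert[of a] in_ideal_generated_2)
  also have "\<dots> \<longleftrightarrow> (\<exists>u v w. x = u * a + v * b + w * c)" by (simp add: algebra_simps)
  finally show ?thesis .
qed

lemma ideal_generated_add:
  "x \<in> ideal_generated S \<Longrightarrow> y \<in> ideal_generated S \<Longrightarrow> (x::'a::comm_ring_1) + y \<in> ideal_generated S"
  unfolding ideal_generated_def by (rule module.span_add[OF module_times])

lemma ideal_generated_mult:
  "x \<in> ideal_generated S \<Longrightarrow> (k::'a::comm_ring_1) * x \<in> ideal_generated S"
  unfolding ideal_generated_def by (rule module.span_scale[OF module_times])

lemma ideal_generated_base: "(x::'a::comm_ring_1) \<in> S \<Longrightarrow> x \<in> ideal_generated S"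
  unfolding ideal_generated_def by (rule module.span_base[OF module_times])

text \<open>In a domain the first condition is just \<open>f \<noteq> 0\<close>, membership in a
  principal ideal is divisibility, and an ideal is proper if it misses 1.\<close>

lemma regular_sequence_3:
  fixes f g h :: "'a::idom"
  assumes "f \<noteq> 0"
  shows "regular_sequence [f, g, h] \<longleftrightarrow>
    (\<forall>x. f dvd g * x \<longrightarrow> f dvd x) \<and>
    (\<forall>x. h * x \<in> ideal_generated {f, g} \<longrightarrow> x \<in> ideal_generated {f, g}) \<and>
    1 \<notin> ideal_generated {f, g, h}"
proof -
  have "ideal_generated {f, g, h} \<noteq> UNIV \<longleftrightarrow> 1 \<notin> ideal_generated {f, g, h}"
    using ideal_generated_mult[of 1 "{f, g, h}"] by auto
  thus ?thesis using assms
    by (auto simp: regular_sequence_def All_less_Suc numeral_3_eq_3 in_ideal_generated_1 ideal_generated_empty)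
qed

text \<open>By Cramer's rule the determinant \<open>D\<close> of the coefficients satisfies \<open>D p, D q \<in> (f, g)\<close>, so
  regularity of \<open>h\<close> puts \<open>D\<close> into \<open>(f, g)\<close>, and then regularity of \<open>g\<close> yields \<open>1 \<in> (p, q)\<close>.\<close>
lemma not_regular_if_in_two_generated:
  fixes f g h :: "'a::idom"
  assumes "f \<in> ideal_generated {p, q}" "g \<in> ideal_generated {p, q}" "h \<in> ideal_generated {p, q}"
    and "1 \<notin> ideal_generated {p, q}" "f \<noteq> 0"
  shows "\<not> regular_sequence [f, g, h]"
proof
  assume "regular_sequence [f, g, h]"
  hence reg1: "\<And>x. f dvd g * x \<Longrightarrow> f dvd x"
    and reg2: "\<And>x. h * x \<in> ideal_generated {f, g} \<Longrightarrow> x \<in> ideal_generated {f, g}"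
    using regular_sequence_3[OF \<open>f \<noteq> 0\<close>] by blast+
  obtain a b where f: "f = a * p + b * q" using assms(1) in_ideal_generated_2 by blast
  obtain c d where g: "g = c * p + d * q" using assms(2) in_ideal_generated_2 by blast
  obtain k l where h: "h = k * p + l * q" using assms(3) in_ideal_generated_2 by blast
  define D where "D = a * d - b * c"
  have Dp: "D * p = d * f - b * g" and Dq: "D * q = a * g - c * f"
    by (simp_all add: D_def f g algebra_simps)
  have "h * D = k * (D * p) + l * (D * q)" by (simp add: h algebra_simps)
  also have "\<dots> = (k * d - l * c) * f + (l * a - k * b) * g" unfolding Dp Dq by (simp add: algebra_simps)
  finally have "D \<in> ideal_generated {f, g}" using reg2 in_ideal_generated_2 by blast
  then obtain u v where D: "D = u * f + v * g" using in_ideal_generated_2 by blast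
  have "g * (b + v * p) = f * (d - u * p)" using Dp unfolding D by (simp add: algebra_simps)
  hence "f dvd b + v * p" using reg1 dvd_triv_left by metis
  then obtain w where w: "b + v * p = f * w" by blast
  have "g * (a - v * q) = f * (c + u * q)" using Dq unfolding D by (simp add: algebra_simps)
  hence "f dvd a - v * q" using reg1 dvd_triv_left by metis
  then obtain s where s: "a - v * q = f * s" by blast
  \<comment> \<open>Adding the trivial syzygy (- v q, v p) to the coefficients of \<open>f\<close>
    makes both divisible by \<open>f\<close>, which then cancels.\<close>
  have "f = (a - v * q) * p + (b + v * p) * q" by (simp add: f algebra_simps)
  also have "\<dots> = f * (s * p + w * q)" unfolding w s by (simp add: algebra_simps)
  finally have "f * 1 = f * (s * p + w * q)" by simp
  hence "1 = s * p + w * q" using \<open>f \<noteq> 0\<close> by (simp only: mult_cancel_left) simp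
  thus False using assms(4) in_ideal_generated_2 by blast
qed

section \<open>Power sums modulo the first two elementary symmetric polynomials\<close>

text \<open>Modulo the two generators Newton's recursion becomes p_(k+3) = xyz p_k, which lowers the
  index by 3 down to 1 or 2.\<close>

lemma power_sum_in_ideal:
  assumes "\<not> 3 dvd m"
  shows "power_sum m \<in> ideal_generated
    {power_sum 1, var_x * var_y + var_y * var_z + var_z * var_x}" (is "_ \<in> ?I")
  using assms
proof (induction m rule: less_induct)
  case (less m)
  have "m = 0 \<or> m = 1 \<or> m = 2 \<or> m = (m - 3) + 3" by linarith
  then consider "m = 0" | "m = 1" | "m = 2" | k where "m = k + 3" by blast
  thus ?case
  proof cases
    case 1
    thus ?thesis using less by simp
  next
    case 2
    thus ?thesis by (simp add: ideal_generated_base)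
  next
    case 3
    have "power_sum m = power_sum 1 * power_sum 1 + (- 2) * (var_x * var_y + var_y * var_z + var_z * var_x)"
      unfolding 3 power_sum_def by (simp add: power2_eq_square algebra_simps)
    thus ?thesis unfolding in_ideal_generated_2 by blast
  next
    case 4
    have "power_sum k \<in> ?I" using less 4 by (intro less.IH) auto
    moreover have "power_sum m = var_x * var_y * var_z * power_sum k + (power_sum (k + 2) * power_sum 1
        + (- power_sum (k + 1)) * (var_x * var_y + var_y * var_z + var_z * var_x))"
      unfolding 4 power_sum_def by (simp add: power_add power2_eq_square power3_eq_cube algebra_simps)
    ultimately show ?thesis
      using in_ideal_generated_2 by (metis ideal_generated_add ideal_generated_mult)
  qed
qed

lemma power_sum_nonzero: "power_sum m \<noteq> 0"
proof
  assume "power_sum m = 0"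
  hence "poly (poly (poly (power_sum m) [:[:1:]:]) [:1:]) 1 = (0::complex)" by simp
  thus False unfolding eval_power_sum by simp
qed

lemma not_regular_power_sums:
  assumes "\<not> 3 dvd k" "\<not> 3 dvd m" "\<not> 3 dvd n"
  shows "\<not> regular_sequence [power_sum k, power_sum m, power_sum n]"
proof (rule not_regular_if_in_two_generated)
  let ?ev = "\<lambda>p::poly_xyz. poly (poly (poly p [:[:0:]:]) [:0:]) (0::complex)"
  show "1 \<notin> ideal_generated {power_sum 1, var_x * var_y + var_y * var_z + var_z * var_x}"
  proof
    assume "1 \<in> ideal_generated {power_sum 1, var_x * var_y + var_y * var_z + var_z * var_x}"
    then obtain u v where "1 = u * power_sum 1 + v * (var_x * var_y + var_y * var_z + var_z * var_x)"
      using in_ideal_generated_2 by blast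
    from arg_cong[OF this, of ?ev] show False
      by (simp add: power_sum_def var_x_def var_y_def var_z_def)
  qed
qed (intro power_sum_in_ideal power_sum_nonzero assms)+

section \<open>Elimination and cancellation\<close>

text \<open>Pseudo-division by a monic polynomial is true division, even over a domain. The
  remainder times \<open>D\<close> is divisible by \<open>f\<close> but has smaller degree, so it
  vanishes.\<close>

lemma monic_dvd_mult_const:
  fixes f g :: "'a::idom poly"
  assumes monic: "lead_coeff f = 1" and D: "D \<noteq> 0" and dvd: "f dvd [:D:] * g"
  shows "f dvd g"
proof -
  have f0: "f \<noteq> 0" using monic by auto
  obtain q r where qr: "pseudo_divmod g f = (q, r)" by (cases "pseudo_divmod g f")
  from pseudo_divmod[OF f0 qr] monic have g: "g = f * q + r" and r: "r = 0 \<or> degree r < degree f"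
    by auto
  have "f dvd [:D:] * r"
  proof -
    have "[:D:] * r = [:D:] * g - f * ([:D:] * q)" by (simp add: g algebra_simps)
    thus ?thesis using dvd by (simp only: dvd_diff dvd_triv_left)
  qed
  moreover have "degree ([:D:] * r) = degree r" using D by simp
  ultimately have "r = 0" using r D f0
    by (metis dvd_imp_degree_le leD mult_eq_0_iff pCons_eq_0_iff)
  thus ?thesis using g by simp
qed

text \<open>\<open>D\<close> acts as a resultant: a nonzero constant in the ideal of
  \<open>f\<close> and \<open>h\<close>.\<close>

lemma monic_dvd_cancel:
  fixes f h x :: "'a::idom poly"
  assumes monic: "lead_coeff f = 1" and D: "D \<noteq> 0" "[:D:] = u * f + v * h" and dvd: "f dvd h * x"
  shows "f dvd x"
proof (rule monic_dvd_mult_const[OF monic D(1)])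
  have "[:D:] * x = f * (u * x) + v * (h * x)" unfolding D(2) by (simp add: algebra_simps)
  thus "f dvd [:D:] * x" using dvd by simp
qed

text \<open>Modulo \<open>q + z\<^sup>r\<close> and \<open>p + z ^ (r + 1)\<close> one has \<open>p = z q\<close>, which eliminates \<open>z\<close>.\<close>

lemma eliminate_two:
  fixes p q z :: "'a::comm_ring_1"
  obtains u v where "p ^ r + q ^ (r + 1) = u * (q + z ^ r) + v * (p + z ^ (r + 1))"
proof -
  let ?s = "\<Sum>i<r. (z * q) ^ (r - Suc i) * p ^ i"
  have "p ^ r - (z * q) ^ r = (p - z * q) * ?s" by (rule power_diff_sumr2)
  hence "p ^ r + q ^ (r + 1) = q ^ r * (q + z ^ r) + (p - z * q) * ?s"
    by (simp add: power_mult_distrib algebra_simps)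
  also have "\<dots> = (q ^ r - z * ?s) * (q + z ^ r) + ?s * (p + z ^ (r + 1))" by (simp add: algebra_simps)
  finally show ?thesis by (rule that)
qed

text \<open>Again p = z q modulo the first two, so p^m = q^m z^m, and the third relation replaces
  z^m by - s.\<close>

lemma eliminate_three:
  fixes p q s z :: "'a::comm_ring_1"
  obtains u v w where "p ^ m + q ^ m * s = u * (q + z ^ r) + v * (p + z ^ (r + 1)) + w * (s + z ^ m)"
proof -
  let ?t = "\<Sum>i<m. (z * q) ^ (m - Suc i) * p ^ i"
  have "p ^ m - (z * q) ^ m = (p - z * q) * ?t" by (rule power_diff_sumr2)
  hence "p ^ m + q ^ m * s = q ^ m * (s + z ^ m) + (p - z * q) * ?t"
    by (simp add: power_mult_distrib algebra_simps)
  also have "\<dots> = (- z * ?t) * (q + z ^ r) + ?t * (p + z ^ (r + 1)) + q ^ m * (s + z ^ m)"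
    by (simp add: algebra_simps)
  finally show ?thesis by (rule that)
qed

lemma lead_coeff_const_plus_power:
  fixes q :: "'a::idom"
  assumes "r \<ge> 1"
  shows "lead_coeff ([:q:] + [:0, 1:] ^ r) = 1"
proof -
  have "degree ([:q:] + [:0, 1:] ^ r) = r"
    using assms by (subst degree_add_eq_right) (auto simp: degree_power_eq)
  thus ?thesis using assms by (simp add: coeff_pCons' coeff_linear_power)
qed

text \<open>The divisor is monic in the outer variable and the eliminant of
  \<open>eliminate_two\<close> serves as \<open>D\<close>. It is applied over C[x,y] and, after
  setting z = 0, over C[x].\<close>

lemma const_plus_power_dvd_cancel:
  fixes p q :: "'a::idom"
  assumes "r \<ge> 1" "p ^ r + q ^ (r + 1) \<noteq> 0" "[:q:] + [:0, 1:] ^ r dvd ([:p:] + [:0, 1:] ^ (r + 1)) * x"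
  shows "[:q:] + [:0, 1:] ^ r dvd x"
proof -
  obtain u v where uv: "[:p:] ^ r + [:q:] ^ (r + 1) = u * ([:q:] + [:0, 1:] ^ r) + v * ([:p:] + [:0, 1:] ^ (r + 1))"
    by (rule eliminate_two)
  have "[:p ^ r + q ^ (r + 1):] = [:p:] ^ r + [:q:] ^ (r + 1)" by (simp add: poly_const_pow)
  thus ?thesis unfolding uv
    by (rule monic_dvd_cancel[OF lead_coeff_const_plus_power[OF assms(1)] assms(2) _ assms(3)])
qed

text \<open>At 0 the relation z p = a f + b h becomes a syzygy of the two constant terms, which by
  \<open>cancel\<close> is a multiple of the trivial one. Subtracting that multiple makes both
  coefficients divisible by the variable.\<close>

lemma var_cancel_mod_two:
  fixes f h :: "'a::idom poly"
  assumes f0: "poly f 0 \<noteq> 0" and cancel: "\<And>x. poly f 0 dvd poly h 0 * x \<Longrightarrow> poly f 0 dvd x"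
    and p: "[:0, 1:] * p \<in> ideal_generated {f, h}"
  shows "p \<in> ideal_generated {f, h}"
proof -
  obtain a b where ab: "[:0, 1:] * p = a * f + b * h" using p in_ideal_generated_2 by blast
  have 0: "poly a 0 * poly f 0 + poly b 0 * poly h 0 = 0"
    using arg_cong[OF ab, of "\<lambda>p. poly p 0"] by simp
  hence "poly h 0 * poly b 0 = poly f 0 * (- poly a 0)" by (simp add: algebra_simps eq_neg_iff_add_eq_0)
  hence "poly f 0 dvd poly b 0" using cancel dvd_triv_left by metis
  then obtain s where s: "poly b 0 = poly f 0 * s" by blast
  have "poly f 0 * (poly a 0 + s * poly h 0) = 0" using 0 unfolding s by (simp add: algebra_simps)
  hence a0: "poly a 0 + s * poly h 0 = 0" using f0 by simp
  have dvd: "[:0, 1:] dvd g" if "poly g 0 = 0" for g :: "'a poly"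
    using that by (simp add: poly_eq_0_iff_dvd)
  obtain a' where a': "a + [:s:] * h = [:0, 1:] * a'" using dvd[of "a + [:s:] * h"] a0 by auto
  obtain b' where b': "b - [:s:] * f = [:0, 1:] * b'" using dvd[of "b - [:s:] * f"] s by (auto simp: mult.commute)
  have "[:0, 1:] * p = (a + [:s:] * h) * f + (b - [:s:] * f) * h" unfolding ab by (simp add: algebra_simps)
  also have "\<dots> = [:0, 1:] * (a' * f + b' * h)" unfolding a' b' by (simp only: distrib_left mult.assoc)
  finally have "p = a' * f + b' * h" by (simp only: mult_cancel_left) simp
  thus ?thesis using in_ideal_generated_2 by blast
qed

lemma power_cancel_mod:
  fixes z :: "'a::comm_ring_1"
  assumes "\<And>x. z * x \<in> I \<Longrightarrow> x \<in> I" "z ^ n * x \<in> I"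
  shows "x \<in> I"
  using assms(2) by (induction n) (auto simp: mult.assoc intro: assms(1))

section \<open>Binary forms without common zeros\<close>

text \<open>Formally z^n u(y/z) when \<open>degree u \<le> n\<close>. The separate formal degree
  \<open>n\<close> keeps the map additive even if leading terms cancel.\<close>

definition homogenize :: "poly_xyz \<Rightarrow> poly_xyz \<Rightarrow> nat \<Rightarrow> complex poly \<Rightarrow> poly_xyz" where
  "homogenize y z n u = (\<Sum>i\<le>n. [:[:[:coeff u i:]:]:] * y ^ i * z ^ (n - i))"

lemma homogenize_0 [simp]: "homogenize y z n 0 = 0"
  by (simp add: homogenize_def)

lemma homogenize_add: "homogenize y z n (u + v) = homogenize y z n u + homogenize y z n v"
proof -
  have "[:[:[:coeff (u + v) i:]:]:] = [:[:[:coeff u i:]:]:] + [:[:[:coeff v i:]:]:]" for i by simp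
  thus ?thesis by (simp only: homogenize_def distrib_right sum.distrib)
qed

lemma homogenize_smult: "homogenize y z n (smult a u) = [:[:[:a:]:]:] * homogenize y z n u"
proof -
  have "[:[:[:coeff (smult a u) i:]:]:] = [:[:[:a:]:]:] * [:[:[:coeff u i:]:]:]" for i by simp
  thus ?thesis by (simp only: homogenize_def sum_distrib_left mult.assoc)
qed

lemma homogenize_pCons:
  "homogenize y z (Suc n) (pCons a u) = [:[:[:a:]:]:] * z ^ Suc n + y * homogenize y z n u"
  unfolding homogenize_def sum.atMost_Suc_shift sum_distrib_left
  by (simp only: coeff_pCons_0 coeff_pCons_Suc diff_Suc_Suc power_Suc mult_ac diff_zero power_0 mult_1_left)

lemma homogenize_Suc:
  assumes "degree u \<le> n"
  shows "homogenize y z (Suc n) u = z * homogenize y z n u"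
proof -
  have "coeff u (Suc n) = 0" using assms by (simp add: coeff_eq_0)
  moreover have "z ^ (Suc n - i) = z * z ^ (n - i)" if "i \<in> {..n}" for i
    using that by (simp add: Suc_diff_le)
  ultimately show ?thesis unfolding homogenize_def sum_distrib_left
    by (simp only: sum.atMost_Suc pCons_0_0 mult_zero_left add_0_right)
       (intro sum.cong refl, simp only: mult_ac)
qed

lemma homogenize_add_degree:
  assumes "degree u \<le> n"
  shows "homogenize y z (k + n) u = z ^ k * homogenize y z n u"
proof (induction k)
  case (Suc k)
  have "homogenize y z (Suc (k + n)) u = z * homogenize y z (k + n) u"
    by (rule homogenize_Suc) (use assms in simp)
  thus ?case using Suc by (simp add: mult.assoc)
qed simp

lemma homogenize_mult:
  assumes "degree u \<le> n" "degree v \<le> k"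
  shows "homogenize y z (n + k) (u * v) = homogenize y z n u * homogenize y z k v"
  using assms(1)
proof (induction u arbitrary: n)
  case (pCons a u)
  show ?case
  proof (cases n)
    case 0
    hence "u = 0" using pCons by (auto split: if_splits)
    moreover have "homogenize y z 0 [:a:] = [:[:[:a:]:]:]" by (simp add: homogenize_def)
    ultimately show ?thesis using 0 by (simp only: mult_pCons_left mult_zero_left pCons_0_0 add_0_right add_0 homogenize_smult)
  next
    case (Suc m)
    hence "degree u \<le> m" using pCons by (auto split: if_splits)
    hence IH: "homogenize y z (m + k) (u * v) = homogenize y z m u * homogenize y z k v" by (rule pCons.IH)
    have "homogenize y z (n + k) (pCons a u * v)
        = homogenize y z (Suc m + k) (smult a v) + homogenize y z (Suc (m + k)) (pCons 0 (u * v))"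
      by (simp only: Suc mult_pCons_left homogenize_add add_Suc)
    also have "\<dots> = [:[:[:a:]:]:] * (z ^ Suc m * homogenize y z k v) + y * (homogenize y z m u * homogenize y z k v)"
      by (simp only: homogenize_smult homogenize_add_degree[OF assms(2)] homogenize_pCons IH) simp
    also have "\<dots> = homogenize y z n (pCons a u) * homogenize y z k v"
      by (simp only: Suc homogenize_pCons distrib_right mult.assoc)
    finally show ?thesis .
  qed
qed simp

lemma homogenize_1: "homogenize y z n 1 = z ^ n"
  using homogenize_add_degree[of 1 0 y z n] by (simp add: homogenize_def flip: one_pCons)

lemma homogenize_power:
  assumes "degree u \<le> n"
  shows "homogenize y z (n * k) (u ^ k) = homogenize y z n u ^ k"
proof (induction k)
  case (Suc k)
  have "degree (u ^ k) \<le> n * k"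
    using degree_power_le[of u k] mult_le_mono1[OF assms, of k] by linarith
  from homogenize_mult[OF assms this] show ?case using Suc by simp
qed (simp add: homogenize_def flip: one_pCons)

lemma homogenize_linear_power: "homogenize y z n ([:0, 1:] ^ n) = y ^ n"
proof -
  have "homogenize y z 1 [:0, 1:] = y" by (simp add: homogenize_def flip: one_pCons)
  thus ?thesis using homogenize_power[of "[:0, 1:]" 1 y z n] by simp
qed

lemma homogenize_linear_power_plus_1: "homogenize y z n ([:0, 1:] ^ n + 1) = y ^ n + z ^ n"
  by (simp only: homogenize_add homogenize_linear_power homogenize_1)

text \<open>A common factor without complex roots is constant, so the gcd can be scaled to
  1.\<close>

lemma bezout_no_common_root:
  fixes p q :: "complex poly"
  assumes "\<And>t. poly p t = 0 \<Longrightarrow> poly q t \<noteq> 0"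
  obtains u v where "u * p + v * q = 1"
proof -
  define g where "g = gcd p q"
  have "poly g t \<noteq> 0" for t
    using assms[of t] gcd_dvd1[of p q] gcd_dvd2[of p q] unfolding g_def by (metis dvdE poly_mult mult_zero_left)
  hence "degree g = 0" "g \<noteq> 0" using fundamental_theorem_of_algebra[of g] constant_degree[of g] by auto
  then obtain c where c: "g = [:c:]" "c \<noteq> 0" by (metis degree_eq_zeroE pCons_0_0)
  obtain u v where uv: "u * p + v * q = g" unfolding g_def using bezout_coefficients_fst_snd by blast
  have "([:1 / c:] * u) * p + ([:1 / c:] * v) * q = [:1 / c:] * g" unfolding uv[symmetric] by (simp add: algebra_simps)
  also have "\<dots> = 1" using c by (simp add: one_pCons)
  finally show ?thesis by (rule that)
qed

text \<open>The Bezout identity is homogenised; its right side 1 becomes a power of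
  \<open>z\<close>.\<close>

lemma power_in_homogeneous_ideal:
  fixes p q :: "complex poly"
  assumes "degree p \<le> m" "degree q \<le> n" "\<And>t. poly p t = 0 \<Longrightarrow> poly q t \<noteq> 0"
  obtains N u v where "z ^ N = u * homogenize y z m p + v * homogenize y z n q"
proof -
  obtain u v where uv: "u * p + v * q = 1" using bezout_no_common_root[OF assms(3)] by blast
  \<comment> \<open>A common bound, so that both products receive the formal degree k + m +
    n.\<close>
  define k where "k = max (degree u) (degree v)"
  have "homogenize y z ((k + n) + m) (u * p) = homogenize y z (k + n) u * homogenize y z m p"
    by (rule homogenize_mult) (use assms k_def in auto)
  moreover have "homogenize y z ((k + m) + n) (v * q) = homogenize y z (k + m) v * homogenize y z n q"
    by (rule homogenize_mult) (use assms k_def in auto)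
  moreover have "(k + n) + m = (k + m) + n" by simp
  ultimately have "homogenize y z ((k + n) + m) (u * p + v * q) =
      homogenize y z (k + n) u * homogenize y z m p + homogenize y z (k + m) v * homogenize y z n q"
    by (simp only: homogenize_add)
  thus ?thesis unfolding uv homogenize_1 by (rule that)
qed


section \<open>Regularity of power sums\<close>

lemma power_sum_eq: "power_sum m = [:[:[:0, 1:] ^ m:] + [:0, 1:] ^ m:] + [:0, 1:] ^ m"
  by (simp add: power_sum_def var_x_def var_y_def var_z_def poly_const_pow one_pCons)

lemma power_sum_at_z_0:
  assumes "m \<ge> 1"
  shows "poly (power_sum m) 0 = [:[:0, 1:] ^ m:] + [:0, 1:] ^ m"
  using assms by (simp add: power_sum_eq)

lemma power_sum_dvd_cancel:
  assumes r: "r \<ge> 1" and dvd: "power_sum r dvd power_sum (r + 1) * x"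
  shows "power_sum r dvd x"
proof -
  let ?q = "\<lambda>m. [:[:0, 1:] ^ m:] + [:0, 1:] ^ m :: complex poly poly"
  \<comment> \<open>The eliminant is nonzero because its value at x = y = 1 is.\<close>
  have "poly (poly (?q (r + 1) ^ r + ?q r ^ (r + 1)) [:1:]) 1 = (2 ^ r + 2 ^ (r + 1) :: complex)" by simp
  also have "\<dots> = 3 * 2 ^ r" by simp
  finally have "?q (r + 1) ^ r + ?q r ^ (r + 1) \<noteq> 0" by (metis mult_eq_0_iff poly_0 power_not_zero zero_neq_numeral)
  thus ?thesis using const_plus_power_dvd_cancel[OF r] dvd unfolding power_sum_eq by blast
qed

lemma power_sum_at_z_0_dvd_cancel:
  assumes r: "r \<ge> 1" and dvd: "poly (power_sum r) 0 dvd poly (power_sum (r + 1)) 0 * x"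
  shows "poly (power_sum r) 0 dvd x"
proof -
  let ?x = "[:0, 1:] :: complex poly"
  have "poly ((?x ^ (r + 1)) ^ r + (?x ^ r) ^ (r + 1)) 1 = 2" by simp
  hence "(?x ^ (r + 1)) ^ r + (?x ^ r) ^ (r + 1) \<noteq> 0" by (metis poly_0 zero_neq_numeral)
  thus ?thesis using const_plus_power_dvd_cancel[OF r, of "?x ^ (r + 1)" "?x ^ r" x] dvd
    unfolding power_sum_at_z_0[OF r] power_sum_at_z_0[OF le_add2] by blast
qed

text \<open>Eliminating \<open>x\<close> leaves two binary forms in \<open>y, z\<close>; a common root of their dehomogenisations
  would lift to a common zero of the three power sums with \<open>z = 1\<close>.\<close>

lemma var_z_power_in_power_sum_ideal:
  assumes r: "r \<ge> 1" and m: "m \<ge> 1"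
    and no_zero: "\<And>a b. a ^ r + b ^ r + 1 = 0 \<Longrightarrow> a ^ (r + 1) + b ^ (r + 1) + 1 = 0 \<Longrightarrow>
      a ^ m + b ^ m + 1 \<noteq> (0::complex)"
  obtains N where "var_z ^ N \<in> ideal_generated {power_sum r, power_sum (r + 1), power_sum m}"
proof -
  let ?I = "ideal_generated {power_sum r, power_sum (r + 1), power_sum m}"
  define s where "s n = [:0, 1:] ^ n + (1 :: complex poly)" for n
  define S where "S n = var_y ^ n + var_z ^ n" for n
  \<comment> \<open>\<open>p\<close> and \<open>q\<close> are the eliminants of
    \<open>eliminate_two\<close> and \<open>eliminate_three\<close> with z set to 1 and y as the
    variable.\<close>
  define p where "p = s (r + 1) ^ r + s r ^ (r + 1)"
  define q where "q = s (r + 1) ^ m + s r ^ m * s m"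
  have deg_s: "degree (s n) \<le> n" for n
    unfolding s_def by (rule degree_add_le) (simp_all add: degree_power_eq)
  have deg_pow: "degree (s n ^ k) \<le> n * k" for n k
    using degree_power_le[of "s n" k] mult_le_mono1[OF deg_s[of n], of k] by linarith
  have hom_s: "homogenize var_y var_z n (s n) = S n" for n
    unfolding s_def S_def by (rule homogenize_linear_power_plus_1)
  have hom_pow: "homogenize var_y var_z (n * k) (s n ^ k) = S n ^ k" for n k
    by (simp only: homogenize_power[OF deg_s] hom_s)
  have hom_p: "homogenize var_y var_z ((r + 1) * r) p = S (r + 1) ^ r + S r ^ (r + 1)"
    unfolding p_def homogenize_add hom_pow
    by (subst mult.commute[of "r + 1" r]) (simp only: hom_pow)
  have hom_q: "homogenize var_y var_z ((r + 1) * m) q = S (r + 1) ^ m + S r ^ m * S m"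
  proof -
    have "(r + 1) * m = r * m + m" by simp
    hence "homogenize var_y var_z ((r + 1) * m) (s r ^ m * s m) = S r ^ m * S m"
      by (simp only: homogenize_mult[OF deg_pow deg_s] hom_pow hom_s)
    thus ?thesis by (simp only: q_def homogenize_add hom_pow)
  qed
  have deg_p: "degree p \<le> (r + 1) * r"
    unfolding p_def using deg_pow[of "r + 1" r] deg_pow[of r "r + 1"]
    by (intro degree_add_le) (simp_all only: mult.commute)
  have "degree (s r ^ m * s m) \<le> r * m + m"
    using degree_mult_le[of "s r ^ m" "s m"] deg_pow[of r m] deg_s[of m] by linarith
  hence deg_q: "degree q \<le> (r + 1) * m"
    unfolding q_def using deg_pow[of "r + 1" m] by (intro degree_add_le) simp_all
  have no_root: "poly q t \<noteq> 0" if pt: "poly p t = 0" for t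
  proof
    assume qt: "poly q t = 0"
    define Q P M where "Q = t ^ r + 1" and "P = t ^ (r + 1) + 1" and "M = t ^ m + 1"
    have 1: "P ^ r + Q ^ (r + 1) = 0" using pt by (simp add: p_def s_def P_def Q_def)
    have 2: "P ^ m + Q ^ m * M = 0" using qt by (simp add: q_def s_def P_def Q_def M_def)
    have "Q \<noteq> 0"
    proof
      assume "Q = 0"
      hence "P = 0" using 1 by simp
      from \<open>Q = 0\<close> have "t ^ r = - 1" by (simp add: Q_def eq_neg_iff_add_eq_0)
      moreover from this have "t = 1" using \<open>P = 0\<close> by (simp add: P_def)
      ultimately show False by simp
    qed
    \<comment> \<open>Elimination rested on P = x Q, so this quotient recovers the x-coordinate of a
      common zero (a, t, 1).\<close>
    define a where "a = P / Q"
    have P: "P = a * Q" using \<open>Q \<noteq> 0\<close> by (simp add: a_def)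
    have "Q ^ r * (a ^ r + Q) = 0" using 1 by (simp add: P power_mult_distrib algebra_simps)
    hence aQ: "a ^ r + Q = 0" using \<open>Q \<noteq> 0\<close> by simp
    have "a ^ (r + 1) + P = a * (a ^ r + Q)" by (simp add: P algebra_simps)
    hence aP: "a ^ (r + 1) + P = 0" using aQ by simp
    have "Q ^ m * (a ^ m + M) = 0" using 2 by (simp add: P power_mult_distrib algebra_simps)
    hence "a ^ m + M = 0" using \<open>Q \<noteq> 0\<close> by simp
    thus False using no_zero[of a t] aQ aP by (simp add: P_def Q_def M_def add.assoc)
  qed
  obtain N u v where N: "var_z ^ N = u * (S (r + 1) ^ r + S r ^ (r + 1)) + v * (S (r + 1) ^ m + S r ^ m * S m)"
    using power_in_homogeneous_ideal[OF deg_p deg_q no_root, of var_z var_y] unfolding hom_p hom_q by blast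
  have ps: "power_sum n = S n + var_x ^ n" for n by (simp add: power_sum_def S_def algebra_simps)
  have in1: "S (r + 1) ^ r + S r ^ (r + 1) \<in> ?I"
  proof -
    obtain a b where "S (r + 1) ^ r + S r ^ (r + 1) = a * power_sum r + b * power_sum (r + 1)"
      using eliminate_two[where p = "S (r + 1)" and r = r and q = "S r" and z = var_x] unfolding ps by blast
    thus ?thesis by (simp only: ideal_generated_add ideal_generated_mult ideal_generated_base insert_iff simp_thms)
  qed
  have in2: "S (r + 1) ^ m + S r ^ m * S m \<in> ?I"
    using eliminate_three[where p = "S (r + 1)" and m = m and q = "S r" and s = "S m" and r = r and z = var_x] unfolding ps in_ideal_generated_3 by metis
  have "var_z ^ N \<in> ?I"
    unfolding N by (rule ideal_generated_add[OF ideal_generated_mult[OF in1] ideal_generated_mult[OF in2]])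
  thus ?thesis by (rule that)
qed

lemma regular_power_sums:
  assumes r: "r \<ge> 1" and m: "m \<ge> 1"
    and no_zero: "\<And>a b. a ^ r + b ^ r + 1 = 0 \<Longrightarrow> a ^ (r + 1) + b ^ (r + 1) + 1 = 0 \<Longrightarrow>
      a ^ m + b ^ m + 1 \<noteq> (0::complex)"
  shows "regular_sequence [power_sum r, power_sum (r + 1), power_sum m]"
proof -
  let ?J = "ideal_generated {power_sum r, power_sum (r + 1)}"
  have q0: "poly (power_sum r) 0 \<noteq> 0"
    using lead_coeff_const_plus_power[OF r, of "[:0, 1:] ^ r :: complex poly"] unfolding power_sum_at_z_0[OF r]
    by (metis leading_coeff_0_iff zero_neq_one)
  have z: "x \<in> ?J" if "var_z * x \<in> ?J" for x
    by (rule var_cancel_mod_two[OF q0 power_sum_at_z_0_dvd_cancel[OF r] that[unfolded var_z_def]])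
  obtain N where N: "var_z ^ N \<in> ideal_generated {power_sum r, power_sum (r + 1), power_sum m}"
    using var_z_power_in_power_sum_ideal[OF r m no_zero] by blast
  then obtain a b c where abc: "var_z ^ N = a * power_sum r + b * power_sum (r + 1) + c * power_sum m"
    using in_ideal_generated_3 by blast
  have nzd: "x \<in> ?J" if x: "power_sum m * x \<in> ?J" for x
  proof (rule power_cancel_mod[OF z])
    \<comment> \<open>Multiplying the expression for the power of z by \<open>x\<close> leaves only
      multiples of the three elements of \<open>?J\<close>, so z can be cancelled \<open>N\<close>
      times.\<close>
    have "var_z ^ N * x = c * (power_sum m * x) + ((a * x) * power_sum r + (b * x) * power_sum (r + 1))"
      unfolding abc by (simp add: algebra_simps)
    moreover have "(a * x) * power_sum r + (b * x) * power_sum (r + 1) \<in> ?J"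
      using in_ideal_generated_2 by blast
    ultimately show "var_z ^ N * x \<in> ?J"
      by (simp only: ideal_generated_add ideal_generated_mult x)
  qed
  have "1 \<notin> ideal_generated {power_sum r, power_sum (r + 1), power_sum m}"
  proof
    let ?ev = "\<lambda>p::poly_xyz. poly (poly (poly p [:[:0:]:]) [:0:]) (0::complex)"
    assume "1 \<in> ideal_generated {power_sum r, power_sum (r + 1), power_sum m}"
    then obtain u v w where "1 = u * power_sum r + v * power_sum (r + 1) + w * power_sum m"
      using in_ideal_generated_3 by blast
    from arg_cong[OF this, of ?ev] show False
      using r m by (simp add: eval_power_sum power_0_left not_less_eq_eq del: pCons_0_0)
  qed
  thus ?thesis unfolding regular_sequence_3[OF power_sum_nonzero]
    using power_sum_dvd_cancel[OF r] nzd by blast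
qed

theorem theorem1p1:
  fixes r \<epsilon> :: nat
  assumes "r \<ge> 1" and "\<epsilon> \<in> {1, 2}"
  shows "regular_sequence [power_sum r, power_sum (r + 1), power_sum (3 * r + \<epsilon>)]
           \<longleftrightarrow> \<not> [r = 1] (mod 3)"
proof (cases "r mod 3 = 1")
  case True
  hence "\<not> 3 dvd r" "\<not> 3 dvd r + 1" "\<not> 3 dvd 3 * r + \<epsilon>" using assms(2) by (auto, presburger+)
  from not_regular_power_sums[OF this] show ?thesis using True by (simp add: cong_def)
next
  case False
  \<comment> \<open>Only common zeros with last coordinate 1 have to be excluded, hence the instance
    \<open>c = 1\<close>.\<close>
  have "regular_sequence [power_sum r, power_sum (r + 1), power_sum (3 * r + \<epsilon>)]"
    by (rule regular_power_sums) (use power_sums_no_common_zero[OF assms(1) False assms(2), of 1] assms(1) in auto)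
  thus ?thesis using False by (simp add: cong_def)
qed

end
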